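(* For every normalized two-agent instance with additive valuations that is either a goods instance or a chores instance, there exists a randomized allocation that is ex-ante EF, ex-ante EQ, and ex-post EF1.
   Context: An instance consists of agents $N=\{1,\dots,n\}$, a finite set $M$ of indivisible items, and for each agent $i$ an additive valuation $v_i:2^M\to\mathbb{R}$, i.e. $v_i(\emptyset)=0$ and $v_i(S)=\sum_{o\in S}v_i(o)$. It is a goods instance if $v_i(o)\ge0$ for all $i,o$, and a chores instance if $v_i(o)\le0$ for all $i,o$. It is normalized if $v_i(M)=v_j(M)$ for all $i,j\in N$. An allocation $A=(A_1,\dots,A_n)$ is a partition of $M$ into $n$ pairwise disjoint, possibly empty bundles with union $M$. EF1 for goods: for all $i,j\in N$ with $A_j\neq\emptyset$ there is $g\in A_j$ with $v_i(A_i)\ge v_i(A_j\setminus\{g\})$. EF1 for chores: for all $i,j\in N$ with $A_i\neq\emptyset$ there is $c\in A_i$ with $v_i(A_i\setminus\{c\})\ge v_i(A_j)$. A randomized allocation is a probability distribution over deterministic allocations $A^{(1)},\dots,A^{(k)}$ with probabilities $p_1,\dots,p_k\in[0,1]$, $\sum_\ell p_\ell=1$. It is ex-ante EQ if $\sum_\ell p_\ell v_i(A_i^{(\ell)})=\sum_\ell p_\ell v_j(A_j^{(\ell)})$ for all $i,j\in N$, and ex-ante EF if $\sum_\ell p_\ell v_i(A_i^{(\ell)})\ge\sum_\ell p_\ell v_i(A_j^{(\ell)})$ for all $i,j\in N$. It satisfies a property ex-post if every allocation in its support satisfies that property. *)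

theory Defs
  imports "HOL-Probability.Probability_Mass_Function"
begin

type_synonym 'o valuations = "nat \<Rightarrow> 'o set \<Rightarrow> real"
type_synonym 'o alloc = "nat \<Rightarrow> 'o set"

abbreviation agents :: "nat \<Rightarrow> nat set" where
  "agents n \<equiv> {1..n}"

text \<open>The value of a single item \<open>x\<close> for agent \<open>i\<close> is \<open>v i {x}\<close>. Only the values of \<open>v i\<close> with
  \<open>i\<close> an agent, on subsets of \<open>M\<close>, are relevant.\<close>

definition additive_valuation :: "'o set \<Rightarrow> ('o set \<Rightarrow> real) \<Rightarrow> bool" where
  "additive_valuation M u \<longleftrightarrow> u {} = 0 \<and> (\<forall>S\<subseteq>M. u S = (\<Sum>x\<in>S. u {x}))"

definition additive_instance :: "nat \<Rightarrow> 'o set \<Rightarrow> 'o valuations \<Rightarrow> bool" where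
  "additive_instance n M v \<longleftrightarrow> finite M \<and> (\<forall>i\<in>agents n. additive_valuation M (v i))"

definition goods_instance :: "nat \<Rightarrow> 'o set \<Rightarrow> 'o valuations \<Rightarrow> bool" where
  "goods_instance n M v \<longleftrightarrow>
     additive_instance n M v \<and> (\<forall>i\<in>agents n. \<forall>x\<in>M. v i {x} \<ge> 0)"

definition chores_instance :: "nat \<Rightarrow> 'o set \<Rightarrow> 'o valuations \<Rightarrow> bool" where
  "chores_instance n M v \<longleftrightarrow>
     additive_instance n M v \<and> (\<forall>i\<in>agents n. \<forall>x\<in>M. v i {x} \<le> 0)"

definition normalized :: "nat \<Rightarrow> 'o set \<Rightarrow> 'o valuations \<Rightarrow> bool" where
  "normalized n M v \<longleftrightarrow> (\<forall>i\<in>agents n. \<forall>j\<in>agents n. v i M = v j M)"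

definition allocation :: "nat \<Rightarrow> 'o set \<Rightarrow> 'o alloc \<Rightarrow> bool" where
  "allocation n M A \<longleftrightarrow> disjoint_family_on A (agents n) \<and> (\<Union>i\<in>agents n. A i) = M"

definition EF1_goods :: "nat \<Rightarrow> 'o valuations \<Rightarrow> 'o alloc \<Rightarrow> bool" where
  "EF1_goods n v A \<longleftrightarrow>
     (\<forall>i\<in>agents n. \<forall>j\<in>agents n. A j \<noteq> {} \<longrightarrow> (\<exists>g\<in>A j. v i (A i) \<ge> v i (A j - {g})))"

definition EF1_chores :: "nat \<Rightarrow> 'o valuations \<Rightarrow> 'o alloc \<Rightarrow> bool" where
  "EF1_chores n v A \<longleftrightarrow>
     (\<forall>i\<in>agents n. \<forall>j\<in>agents n. A i \<noteq> {} \<longrightarrow> (\<exists>c\<in>A i. v i (A i - {c}) \<ge> v i (A j)))"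

text \<open>Finite support has to be required: an allocation is unconstrained at non-agents, so
  infinitely many functions represent the same partition. It also makes every expectation
  below a finite sum.\<close>

definition randomized_allocation :: "nat \<Rightarrow> 'o set \<Rightarrow> 'o alloc pmf \<Rightarrow> bool" where
  "randomized_allocation n M p \<longleftrightarrow> finite (set_pmf p) \<and> (\<forall>A\<in>set_pmf p. allocation n M A)"

definition ex_ante_EQ :: "nat \<Rightarrow> 'o valuations \<Rightarrow> 'o alloc pmf \<Rightarrow> bool" where
  "ex_ante_EQ n v p \<longleftrightarrow>
     (\<forall>i\<in>agents n. \<forall>j\<in>agents n.
        measure_pmf.expectation p (\<lambda>A. v i (A i)) = measure_pmf.expectation p (\<lambda>A. v j (A j)))"

definition ex_ante_EF :: "nat \<Rightarrow> 'o valuations \<Rightarrow> 'o alloc pmf \<Rightarrow> bool" where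
  "ex_ante_EF n v p \<longleftrightarrow>
     (\<forall>i\<in>agents n. \<forall>j\<in>agents n.
        measure_pmf.expectation p (\<lambda>A. v i (A i)) \<ge> measure_pmf.expectation p (\<lambda>A. v i (A j)))"

definition ex_post :: "('o alloc \<Rightarrow> bool) \<Rightarrow> 'o alloc pmf \<Rightarrow> bool" where
  "ex_post P p \<longleftrightarrow> (\<forall>A\<in>set_pmf p. P A)"

end

(* With normalized valuations, an agent who receives either side of a bipartition (P, Q) of M with
   probability 1/2 has expected value v_i(M) / 2 = v_j(M) / 2 for its own bundle and for the other
   one. So it suffices to find a bipartition that is EF1 for both agents under both assignments of
   its sides; in absolute values this is the same condition for goods and for chores.
   Such a bipartition is built from pairs of items taken in the order of agent 1's values: splitting
   each pair between the sides keeps agent 1's condition whichever way it is done, and agent 2's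
   condition is kept by giving the item that agent 2 values more to the side that is worth less to
   agent 2. *)

theory Submission
  imports Defs
begin

section \<open>Bipartitions that are balanced for two value functions at once\<close>

definition le_up_to_one :: "('o \<Rightarrow> real) \<Rightarrow> 'o set \<Rightarrow> 'o set \<Rightarrow> bool" where
  "le_up_to_one f P Q \<longleftrightarrow> (P \<noteq> {} \<longrightarrow> (\<exists>g\<in>P. sum f (P - {g}) \<le> sum f Q))"

text \<open>Item values enter as a function \<open>f\<close>, so that one argument serves goods,
  with \<open>f\<close> the values, and chores, with \<open>f\<close> their negatives. Both
  directions are demanded because the coin will swap the sides between the agents.\<close>

definition balanced :: "('o \<Rightarrow> real) \<Rightarrow> 'o set \<Rightarrow> 'o set \<Rightarrow> bool" where
  "balanced f P Q \<longleftrightarrow> le_up_to_one f P Q \<and> le_up_to_one f Q P"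

lemma balanced_commute: "balanced f P Q \<longleftrightarrow> balanced f Q P"
  by (auto simp: balanced_def)

text \<open>The old witness \<open>g\<close> is replaced by \<open>x\<close>: dropping
  \<open>x\<close> leaves \<open>P\<close>, which exceeds \<open>Q\<close> by at most
  \<open>f g\<close>, and the incoming \<open>y\<close> makes up for that since
  \<open>f g \<le> f y\<close>.\<close>

lemma le_up_to_one_insert_top:
  assumes le: "le_up_to_one f P Q" and fin: "finite P" "finite Q"
    and notin: "x \<notin> P" "y \<notin> Q" and nonneg: "\<And>z. z \<in> Q \<Longrightarrow> 0 \<le> f z" "0 \<le> f y"
    and top: "\<And>z. z \<in> P \<Longrightarrow> f z \<le> f y"
  shows "le_up_to_one f (insert x P) (insert y Q)"
proof -
  have "sum f P \<le> sum f Q + f y"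
  proof (cases "P = {}")
    case True
    then show ?thesis using nonneg by (simp add: sum_nonneg)
  next
    case False
    then obtain g where g: "g \<in> P" "sum f (P - {g}) \<le> sum f Q"
      using le by (auto simp: le_up_to_one_def)
    then show ?thesis using top[OF g(1)] fin by (simp add: sum_diff1)
  qed
  then have "sum f (insert x P - {x}) \<le> sum f (insert y Q)"
    using fin notin by simp
  then show ?thesis
    unfolding le_up_to_one_def by blast
qed

lemma balanced_insert_top:
  assumes "balanced f P Q" "finite P" "finite Q" "x \<notin> P" "y \<notin> Q"
    and "\<And>z. z \<in> P \<union> Q \<Longrightarrow> 0 \<le> f z \<and> f z \<le> f x \<and> f z \<le> f y" "0 \<le> f x" "0 \<le> f y"
  shows "balanced f (insert x P) (insert y Q)"
  using assms unfolding balanced_def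
  by (intro conjI le_up_to_one_insert_top) auto

text \<open>No comparison between new and old items is assumed. On one side, dropping
  \<open>x\<close> leaves \<open>Q\<close>, which is no heavier than \<open>P\<close>; on the other,
  the old witness still works because \<open>f y \<le> f x\<close>.\<close>

lemma balanced_insert_greedy:
  assumes bal: "balanced f P Q" and fin: "finite P" "finite Q"
    and notin: "x \<notin> Q" "y \<notin> P"
    and nonneg: "\<And>z. z \<in> Q \<Longrightarrow> 0 \<le> f z" "0 \<le> f y"
    and le: "sum f Q \<le> sum f P" "f y \<le> f x"
  shows "balanced f (insert y P) (insert x Q)"
  unfolding balanced_def
proof
  have "sum f (insert x Q - {x}) \<le> sum f (insert y P)"
    using fin notin nonneg le by simp
  then show "le_up_to_one f (insert x Q) (insert y P)"
    unfolding le_up_to_one_def by blast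
  show "le_up_to_one f (insert y P) (insert x Q)"
  proof (cases "P = {}")
    \<comment> \<open>There is no old witness; \<open>y\<close> serves, as dropping it leaves the
      empty bundle.\<close>
    case True
    have "0 \<le> sum f (insert x Q)"
      using nonneg le by (intro sum_nonneg) auto
    then show ?thesis
      using True by (simp add: le_up_to_one_def)
  next
    case False
    then obtain g where g: "g \<in> P" "sum f (P - {g}) \<le> sum f Q"
      using bal by (auto simp: balanced_def le_up_to_one_def)
    have "sum f (insert y P - {g}) \<le> sum f (insert x Q)"
      using fin notin g le by (simp add: sum_diff1)
    then show ?thesis
      using g(1) unfolding le_up_to_one_def by blast
  qed
qed

lemma finite_obtain_top:
  fixes f :: "'o \<Rightarrow> real"
  assumes "finite M" "M \<noteq> {}"
  obtains a where "a \<in> M" "\<And>z. z \<in> M \<Longrightarrow> f z \<le> f a"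
proof -
  have "Max (f ` M) \<in> f ` M"
    using assms by simp
  then obtain a where "a \<in> M" "f a = Max (f ` M)"
    by force
  with assms that show thesis
    by simp
qed

text \<open>Here \<open>f\<close> belongs to agent 1 and \<open>h\<close> to agent 2. The item
  \<open>x\<close>, preferred by \<open>h\<close> within the pair, joins \<open>Q\<close>, the side
  that is lighter for \<open>h\<close>.\<close>

lemma balanced_bipartition_insert_pair:
  assumes "finite M" "\<And>z. z \<in> M \<Longrightarrow> 0 \<le> f z" "\<And>z. z \<in> M \<Longrightarrow> 0 \<le> h z"
    and xy: "x \<in> M" "y \<in> M" "x \<noteq> y"
    and top: "\<And>z. z \<in> M - {x, y} \<Longrightarrow> f z \<le> f x \<and> f z \<le> f y"
    and PQ: "P \<union> Q = M - {x, y}" "P \<inter> Q = {}" "balanced f P Q" "balanced h P Q"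
    and le: "sum h Q \<le> sum h P" "h y \<le> h x"
  shows "\<exists>P Q. P \<union> Q = M \<and> P \<inter> Q = {} \<and> balanced f P Q \<and> balanced h P Q"
proof (intro exI conjI)
  have mem: "z \<in> M - {x, y}" if "z \<in> P \<union> Q" for z
    using that PQ(1) by simp
  have fin: "finite P" "finite Q"
    using PQ(1) assms(1) by (metis finite_Diff finite_Un)+
  have notin: "x \<notin> P" "x \<notin> Q" "y \<notin> P" "y \<notin> Q"
    using mem by auto
  show "insert y P \<union> insert x Q = M"
    using PQ(1) xy by auto
  show "insert y P \<inter> insert x Q = {}"
    using PQ(2) xy(3) notin by auto
  show "balanced f (insert y P) (insert x Q)"
    using mem top assms(2) xy by (intro balanced_insert_top PQ(3) fin notin) auto
  show "balanced h (insert y P) (insert x Q)"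
    using mem assms(3) xy le by (intro balanced_insert_greedy PQ(4) fin notin) auto
qed

lemma ex_balanced_bipartition:
  fixes f h :: "'o \<Rightarrow> real"
  assumes "finite M" "\<And>z. z \<in> M \<Longrightarrow> 0 \<le> f z" "\<And>z. z \<in> M \<Longrightarrow> 0 \<le> h z"
  shows "\<exists>P Q. P \<union> Q = M \<and> P \<inter> Q = {} \<and> balanced f P Q \<and> balanced h P Q"
  using assms
proof (induction M rule: finite_psubset_induct)
  case (psubset M)
  show ?case
  proof (cases "M = {}")
    case True
    then show ?thesis by (simp add: balanced_def le_up_to_one_def)
  next
    case False
    then obtain a where a: "a \<in> M" "\<And>z. z \<in> M \<Longrightarrow> f z \<le> f a"
      using finite_obtain_top psubset.hyps by blast
    show ?thesis
    \<comment> \<open>Items are removed in pairs, so an odd number of them ends with a single one,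
      which forms a side alone.\<close>
    proof (cases "M - {a} = {}")
      case True
      then have "M = {a}" using a by auto
      then have "{a} \<union> {} = M \<and> {a} \<inter> {} = {} \<and> balanced f {a} {} \<and> balanced h {a} {}"
        by (simp add: balanced_def le_up_to_one_def)
      then show ?thesis by blast
    next
      case False
      \<comment> \<open>Both \<open>a\<close> and \<open>b\<close> dominate all remaining items
        under \<open>f\<close>. As this pair is added after the recursive call, pairs enter in
        increasing order of \<open>f\<close>.\<close>
      obtain b where b: "b \<in> M - {a}" "\<And>z. z \<in> M - {a} \<Longrightarrow> f z \<le> f b"
        using finite_obtain_top[OF finite_Diff[OF psubset.hyps] False] by blast
      have "M - {a, b} \<subset> M" using a by auto
      then obtain P Q where PQ: "P \<union> Q = M - {a, b}" "P \<inter> Q = {}"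
        "balanced f P Q" "balanced h P Q"
        using psubset.IH[of "M - {a, b}"] psubset.prems by blast
      \<comment> \<open>\<open>R\<close> is the side heavier for \<open>h\<close>; leaving
        \<open>R\<close> and \<open>S\<close> arbitrary lets either of \<open>P\<close> and
        \<open>Q\<close> take that role. The case split below decides which of \<open>a\<close> and
        \<open>b\<close> is the item preferred by \<open>h\<close>.\<close>
      have step: "\<exists>P Q. P \<union> Q = M \<and> P \<inter> Q = {} \<and> balanced f P Q \<and> balanced h P Q"
        if RS: "R \<union> S = M - {a, b}" "R \<inter> S = {}" "balanced f R S" "balanced h R S"
          and le: "sum h S \<le> sum h R" for R S
      proof (cases "h b \<le> h a")
        case True
        show ?thesis
          using a b by (intro balanced_bipartition_insert_pair
              [OF psubset.hyps psubset.prems _ _ _ _ RS le True]) auto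
      next
        case False
        have "R \<union> S = M - {b, a}" using RS(1) by auto
        then show ?thesis
          using a b False by (intro balanced_bipartition_insert_pair
              [OF psubset.hyps psubset.prems _ _ _ _ _ RS(2-4) le, of b a]) auto
      qed
      show ?thesis
      proof (cases "sum h Q \<le> sum h P")
        case True
        then show ?thesis using step PQ by simp
      next
        case False
        then show ?thesis
          using step[of Q P] PQ by (simp add: balanced_commute Un_commute Int_commute)
      qed
    qed
  qed
qed

section \<open>The fair coin between the two assignments of the sides\<close>

definition two_agent_alloc :: "'o set \<Rightarrow> 'o set \<Rightarrow> 'o alloc" where
  "two_agent_alloc P Q i = (if i = 1 then P else Q)"

definition fair_coin_alloc :: "'o set \<Rightarrow> 'o set \<Rightarrow> 'o alloc pmf" where
  "fair_coin_alloc P Q =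
     map_pmf (\<lambda>c. if c then two_agent_alloc P Q else two_agent_alloc Q P) (bernoulli_pmf (1/2))"

lemma agents_2: "agents 2 = {1, 2}"
  by auto

lemma agents_2E:
  assumes "i \<in> agents 2"
  obtains "i = 1" | "i = 2"
  using assms unfolding agents_2 by blast

lemma set_fair_coin_alloc:
  "set_pmf (fair_coin_alloc P Q) = {two_agent_alloc P Q, two_agent_alloc Q P}"
  by (auto simp: fair_coin_alloc_def UNIV_bool)

lemma randomized_allocation_fair_coin:
  assumes "P \<union> Q = M" "P \<inter> Q = {}"
  shows "randomized_allocation 2 M (fair_coin_alloc P Q)"
  using assms unfolding randomized_allocation_def set_fair_coin_alloc allocation_def agents_2
  by (auto simp: disjoint_family_on_def two_agent_alloc_def)

lemma additive_valuation_Un_disjoint: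
  assumes "additive_valuation M u" "finite M" "P \<union> Q = M" "P \<inter> Q = {}"
  shows "u P + u Q = u M"
proof -
  have "u P = (\<Sum>x\<in>P. u {x})" "u Q = (\<Sum>x\<in>Q. u {x})" "u M = (\<Sum>x\<in>M. u {x})"
    using assms unfolding additive_valuation_def by blast+
  moreover have "finite P" "finite Q"
    using assms(2,3) by (metis finite_Un)+
  ultimately show ?thesis
    using assms(3,4) sum.union_disjoint by metis
qed

text \<open>The evaluator \<open>u\<close> is independent of the holder \<open>j\<close>, so own and
  foreign bundles are covered alike: either way the expectation is the average of \<open>u P\<close>
  and \<open>u Q\<close>.\<close>

lemma expectation_fair_coin:
  assumes "additive_valuation M u" "finite M" "P \<union> Q = M" "P \<inter> Q = {}" "j \<in> agents 2"
  shows "measure_pmf.expectation (fair_coin_alloc P Q) (\<lambda>A. u (A j)) = u M / 2"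
  using additive_valuation_Un_disjoint[OF assms(1-4)]
  by (auto simp: fair_coin_alloc_def two_agent_alloc_def field_simps)

text \<open>Every expectation is \<open>v i M / 2\<close>, so EF holds with equality; normalization
  makes this number the same for both agents, which gives EQ.\<close>

lemma fair_coin_ex_ante:
  assumes "additive_instance 2 M v" "normalized 2 M v" "P \<union> Q = M" "P \<inter> Q = {}"
  shows "ex_ante_EF 2 v (fair_coin_alloc P Q)" "ex_ante_EQ 2 v (fair_coin_alloc P Q)"
proof -
  have E: "measure_pmf.expectation (fair_coin_alloc P Q) (\<lambda>A. v i (A j)) = v i M / 2"
    if "i \<in> agents 2" "j \<in> agents 2" for i j
    using assms that by (intro expectation_fair_coin) (auto simp: additive_instance_def)
  show "ex_ante_EF 2 v (fair_coin_alloc P Q)"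
    unfolding ex_ante_EF_def using E by (metis order_refl)
  show "ex_ante_EQ 2 v (fair_coin_alloc P Q)"
    unfolding ex_ante_EQ_def using E assms(2) unfolding normalized_def by metis
qed

section \<open>From balance to EF1\<close>

lemma le_up_to_one_goods:
  assumes "additive_valuation M u" "P \<subseteq> M" "Q \<subseteq> M" "le_up_to_one (\<lambda>x. u {x}) P Q" "P \<noteq> {}"
  shows "\<exists>g\<in>P. u Q \<ge> u (P - {g})"
proof -
  obtain g where g: "g \<in> P" "(\<Sum>x\<in>P - {g}. u {x}) \<le> (\<Sum>x\<in>Q. u {x})"
    using assms(4,5) by (auto simp: le_up_to_one_def)
  moreover have "P - {g} \<subseteq> M" using assms(2) by blast
  ultimately show ?thesis
    using assms(1,3) unfolding additive_valuation_def by metis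
qed

lemma le_up_to_one_chores:
  assumes "additive_valuation M u" "P \<subseteq> M" "Q \<subseteq> M" "le_up_to_one (\<lambda>x. - u {x}) P Q" "P \<noteq> {}"
  shows "\<exists>c\<in>P. u (P - {c}) \<ge> u Q"
proof -
  obtain c where c: "c \<in> P" "(\<Sum>x\<in>P - {c}. u {x}) \<ge> (\<Sum>x\<in>Q. u {x})"
    using assms(4,5) by (auto simp: le_up_to_one_def sum_negf)
  moreover have "P - {c} \<subseteq> M" using assms(2) by blast
  ultimately show ?thesis
    using assms(1,3) unfolding additive_valuation_def by metis
qed

text \<open>EF1 ranges over all pairs of agents, so the diagonal case \<open>i = j\<close> compares
  a bundle with itself.\<close>

lemma le_up_to_one_refl:
  assumes "finite P" "\<And>z. z \<in> P \<Longrightarrow> 0 \<le> f z"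
  shows "le_up_to_one f P P"
  using assms by (auto simp: le_up_to_one_def sum_diff1)

lemma EF1_goods_two_agent_alloc:
  assumes "goods_instance 2 M v" "P \<subseteq> M" "Q \<subseteq> M"
    and "\<And>i. i \<in> agents 2 \<Longrightarrow> balanced (\<lambda>x. v i {x}) P Q"
  shows "EF1_goods 2 v (two_agent_alloc P Q)"
  unfolding EF1_goods_def
proof (intro ballI impI)
  fix i j assume ij: "i \<in> agents 2" "j \<in> agents 2" and ne: "two_agent_alloc P Q j \<noteq> {}"
  have "finite M" and add: "additive_valuation M (v i)"
    and nonneg: "\<And>x. x \<in> M \<Longrightarrow> 0 \<le> v i {x}"
    using assms(1) ij by (auto simp: goods_instance_def additive_instance_def)
  then have "le_up_to_one (\<lambda>x. v i {x}) P P" "le_up_to_one (\<lambda>x. v i {x}) Q Q"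
    using assms(2,3) finite_subset by (auto intro!: le_up_to_one_refl)
  \<comment> \<open>For goods the item is dropped from the envied bundle, so \<open>j\<close> comes
    first.\<close>
  then have "le_up_to_one (\<lambda>x. v i {x}) (two_agent_alloc P Q j) (two_agent_alloc P Q i)"
    using assms(4)[OF ij(1)] ij
    by (auto elim!: agents_2E simp: two_agent_alloc_def balanced_def)
  then show "\<exists>g\<in>two_agent_alloc P Q j.
      v i (two_agent_alloc P Q i) \<ge> v i (two_agent_alloc P Q j - {g})"
    using assms(2,3) by (intro le_up_to_one_goods[OF add _ _ _ ne]) (auto simp: two_agent_alloc_def)
qed

lemma EF1_chores_two_agent_alloc:
  assumes "chores_instance 2 M v" "P \<subseteq> M" "Q \<subseteq> M"
    and "\<And>i. i \<in> agents 2 \<Longrightarrow> balanced (\<lambda>x. - v i {x}) P Q"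
  shows "EF1_chores 2 v (two_agent_alloc P Q)"
  unfolding EF1_chores_def
proof (intro ballI impI)
  fix i j assume ij: "i \<in> agents 2" "j \<in> agents 2" and ne: "two_agent_alloc P Q i \<noteq> {}"
  have "finite M" and add: "additive_valuation M (v i)"
    and nonneg: "\<And>x. x \<in> M \<Longrightarrow> 0 \<le> - v i {x}"
    using assms(1) ij by (auto simp: chores_instance_def additive_instance_def)
  then have "le_up_to_one (\<lambda>x. - v i {x}) P P" "le_up_to_one (\<lambda>x. - v i {x}) Q Q"
    using assms(2,3) finite_subset by (blast intro: le_up_to_one_refl)+
  \<comment> \<open>For chores the item is dropped from the agent's own bundle, so \<open>i\<close>
    comes first.\<close>
  then have "le_up_to_one (\<lambda>x. - v i {x}) (two_agent_alloc P Q i) (two_agent_alloc P Q j)"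
    using assms(4)[OF ij(1)] ij
    by (auto elim!: agents_2E simp: two_agent_alloc_def balanced_def)
  then show "\<exists>c\<in>two_agent_alloc P Q i.
      v i (two_agent_alloc P Q i - {c}) \<ge> v i (two_agent_alloc P Q j)"
    using assms(2,3) by (intro le_up_to_one_chores[OF add _ _ _ ne]) (auto simp: two_agent_alloc_def)
qed

theorem theorem7:
  fixes M :: "'o set" and v :: "nat \<Rightarrow> 'o set \<Rightarrow> real"
  assumes "normalized 2 M v"
  shows "(goods_instance 2 M v \<longrightarrow>
           (\<exists>p. randomized_allocation 2 M p \<and> ex_ante_EF 2 v p \<and> ex_ante_EQ 2 v p
              \<and> ex_post (EF1_goods 2 v) p)) \<and>
         (chores_instance 2 M v \<longrightarrow>
           (\<exists>p. randomized_allocation 2 M p \<and> ex_ante_EF 2 v p \<and> ex_ante_EQ 2 v p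
              \<and> ex_post (EF1_chores 2 v) p))"
proof (intro conjI impI)
  assume goods: "goods_instance 2 M v"
  then have add: "additive_instance 2 M v"
    by (simp add: goods_instance_def)
  obtain P Q where PQ: "P \<union> Q = M" "P \<inter> Q = {}"
    and bal: "balanced (\<lambda>x. v 1 {x}) P Q" "balanced (\<lambda>x. v 2 {x}) P Q"
    using ex_balanced_bipartition[of M "\<lambda>x. v 1 {x}" "\<lambda>x. v 2 {x}"] goods
    by (auto simp: goods_instance_def additive_instance_def)
  \<comment> \<open>Symmetry of balance makes both outcomes of the coin EF1.\<close>
  have "balanced (\<lambda>x. v i {x}) P Q" "balanced (\<lambda>x. v i {x}) Q P" if "i \<in> agents 2" for i
    using that bal balanced_commute by (metis agents_2E)+
  then have "ex_post (EF1_goods 2 v) (fair_coin_alloc P Q)"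
    using PQ(1) by (auto simp: ex_post_def set_fair_coin_alloc
        intro!: EF1_goods_two_agent_alloc[OF goods])
  then show "\<exists>p. randomized_allocation 2 M p \<and> ex_ante_EF 2 v p \<and> ex_ante_EQ 2 v p
      \<and> ex_post (EF1_goods 2 v) p"
    using randomized_allocation_fair_coin[OF PQ] fair_coin_ex_ante[OF add assms PQ] by blast
next
  assume chores: "chores_instance 2 M v"
  then have add: "additive_instance 2 M v"
    by (simp add: chores_instance_def)
  \<comment> \<open>Negated chore values are nonnegative, so the same bipartition result
    applies.\<close>
  obtain P Q where PQ: "P \<union> Q = M" "P \<inter> Q = {}"
    and bal: "balanced (\<lambda>x. - v 1 {x}) P Q" "balanced (\<lambda>x. - v 2 {x}) P Q"
    using ex_balanced_bipartition[of M "\<lambda>x. - v 1 {x}" "\<lambda>x. - v 2 {x}"] chores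
    by (auto simp: chores_instance_def additive_instance_def)
  have "balanced (\<lambda>x. - v i {x}) P Q" "balanced (\<lambda>x. - v i {x}) Q P" if "i \<in> agents 2" for i
    using that bal balanced_commute by (metis agents_2E)+
  then have "ex_post (EF1_chores 2 v) (fair_coin_alloc P Q)"
    using PQ(1) by (auto simp: ex_post_def set_fair_coin_alloc
        intro!: EF1_chores_two_agent_alloc[OF chores])
  then show "\<exists>p. randomized_allocation 2 M p \<and> ex_ante_EF 2 v p \<and> ex_ante_EQ 2 v p
      \<and> ex_post (EF1_chores 2 v) p"
    using randomized_allocation_fair_coin[OF PQ] fair_coin_ex_ante[OF add assms PQ] by blast
qed

end
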